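(* The functions $$h_6,\qquad h_7,\qquad h_8,\qquad C = h_5^2h_6 - 2h_4h_5h_7 + h_4^2h_8 - 2h_3(h_6h_8-h_7^2)$$ are Casimir functions on $L^*$. If $h_6h_8-h_7^2\neq 0$, then these four functions are independent, and any Casimir function depends functionally on them.
   Context: $L$ is the real 8-dimensional Lie algebra with basis $X_1,\dots,X_8$ and brackets $[X_1,X_2]=X_3$, $[X_1,X_3]=X_4$, $[X_2,X_3]=X_5$, $[X_1,X_4]=X_6$, $[X_1,X_5]=[X_2,X_4]=X_7$, $[X_2,X_5]=X_8$, all other brackets $[X_i,X_j]$ with $i<j$ being zero (the free nilpotent Lie algebra with 2 generators of step 4). $L^*$ is its dual space, with linear coordinates $h_i(\lambda)=\langle\lambda,X_i\rangle$, $i=1,\dots,8$. $L^*$ carries the Lie–Poisson bracket determined by $\{h_i,h_j\}(\lambda)=\langle\lambda,[X_i,X_j]\rangle$. A Casimir function is a smooth function $f:L^*\to\mathbb{R}$ such that $\{f,h_i\}=0$ for all $i=1,\dots,8$. The last sentence of the claim concerns the open set $\{h_6h_8-h_7^2\neq0\}\subset L^*$: "independent" means that the differentials are linearly independent at every point of this set, and "$f$ depends functionally on $h_6,h_7,h_8,C$" means that on this set $f$ is a function of $(h_6,h_7,h_8,C)$. *)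

theory Defs
  imports "HOL-Analysis.Analysis"
begin

text \<open>
  \<open>L\<close> is realised as \<open>real ^ 8\<close>. The index type \<open>8\<close> is the type of integers modulo 8, so its
  elements are \<open>1, \<dots>, 7\<close> and \<open>8\<close>, where \<open>8\<close> coincides with \<open>0\<close>; do not use its order.
\<close>

type_synonym L = "real ^ 8"

abbreviation X :: "8 \<Rightarrow> L" where
  "X i \<equiv> axis i 1"

text \<open>The bilinear alternating extension of the table of brackets of basis vectors, which is
  recovered in \<open>lie_bracket_table\<close> and \<open>lie_bracket_other\<close>.\<close>

definition lie_bracket :: "L \<Rightarrow> L \<Rightarrow> L" where
  "lie_bracket x y =
    (let w = (\<lambda>i j. x $ i * y $ j - x $ j * y $ i)
     in w 1 2 *\<^sub>R X 3 + w 1 3 *\<^sub>R X 4 + w 2 3 *\<^sub>R X 5 + w 1 4 *\<^sub>R X 6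
        + (w 1 5 + w 2 4) *\<^sub>R X 7 + w 2 5 *\<^sub>R X 8)"

lemma UNIV_8_eq: "(UNIV :: 8 set) = {1, 2, 3, 4, 5, 6, 7, 8}"
proof -
  have "card {1, 2, 3, 4, 5, 6, 7, 8 :: 8} = CARD(8)"
    by simp
  then show ?thesis
    by (intro card_subset_eq [symmetric]) simp_all
qed

lemma forall_8: "(\<forall>i :: 8. P i) \<longleftrightarrow> P 1 \<and> P 2 \<and> P 3 \<and> P 4 \<and> P 5 \<and> P 6 \<and> P 7 \<and> P 8"
proof -
  have "(\<forall>i :: 8. P i) \<longleftrightarrow> (\<forall>i \<in> {1, 2, 3, 4, 5, 6, 7, 8}. P i)"
    unfolding UNIV_8_eq [symmetric] by simp
  then show ?thesis
    by simp
qed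

lemma lie_bracket_nth:
  "lie_bracket x y $ 1 = 0" "lie_bracket x y $ 2 = 0"
  "lie_bracket x y $ 3 = x $ 1 * y $ 2 - x $ 2 * y $ 1"
  "lie_bracket x y $ 4 = x $ 1 * y $ 3 - x $ 3 * y $ 1"
  "lie_bracket x y $ 5 = x $ 2 * y $ 3 - x $ 3 * y $ 2"
  "lie_bracket x y $ 6 = x $ 1 * y $ 4 - x $ 4 * y $ 1"
  "lie_bracket x y $ 7 = x $ 1 * y $ 5 - x $ 5 * y $ 1 + (x $ 2 * y $ 4 - x $ 4 * y $ 2)"
  "lie_bracket x y $ 8 = x $ 2 * y $ 5 - x $ 5 * y $ 2"
  by (simp_all add: lie_bracket_def Let_def axis_def)

lemma lie_bracket_table:
  "lie_bracket (X 1) (X 2) = X 3" "lie_bracket (X 1) (X 3) = X 4"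
  "lie_bracket (X 2) (X 3) = X 5" "lie_bracket (X 1) (X 4) = X 6"
  "lie_bracket (X 1) (X 5) = X 7" "lie_bracket (X 2) (X 4) = X 7"
  "lie_bracket (X 2) (X 5) = X 8"
  by (simp_all add: lie_bracket_def Let_def axis_def)

lemma lie_bracket_other:
  assumes "{i, j} \<notin> {{1, 2}, {1, 3}, {2, 3}, {1, 4}, {1, 5}, {2, 4}, {2, 5}}"
  shows "lie_bracket (X i) (X j) = 0"
proof -
  have "\<forall>i j. {i, j} \<notin> {{1, 2}, {1, 3}, {2, 3}, {1, 4}, {1, 5}, {2, 4}, {2, 5}} \<longrightarrow>
      lie_bracket (X i) (X j) = 0"
    unfolding forall_8 by (simp add: lie_bracket_def Let_def axis_def doubleton_eq_iff)
  from this [rule_format, OF assms] show ?thesis .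
qed

lemma lie_bracket_alternating: "lie_bracket x x = 0"
  by (simp add: vec_eq_iff forall_8 lie_bracket_nth)

lemma vec_8_eqI:
  fixes x y :: "'a ^ 8"
  assumes "x $ 1 = y $ 1" "x $ 2 = y $ 2" "x $ 3 = y $ 3" "x $ 4 = y $ 4"
    "x $ 5 = y $ 5" "x $ 6 = y $ 6" "x $ 7 = y $ 7" "x $ 8 = y $ 8"
  shows "x = y"
  using assms by (simp add: vec_eq_iff forall_8)

lemma lie_bracket_linear:
  "lie_bracket (x + x') y = lie_bracket x y + lie_bracket x' y"
  "lie_bracket x (y + y') = lie_bracket x y + lie_bracket x y'"
  "lie_bracket (c *\<^sub>R x) y = c *\<^sub>R lie_bracket x y"
  "lie_bracket x (c *\<^sub>R y) = c *\<^sub>R lie_bracket x y"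
  by (rule vec_8_eqI; simp add: lie_bracket_nth algebra_simps)+

lemma bounded_bilinear_lie_bracket: "bounded_bilinear lie_bracket"
proof -
  have "bilinear lie_bracket"
    unfolding bilinear_def by (auto intro: linearI simp: lie_bracket_linear)
  then show ?thesis
    by (rule bilinear_conv_bounded_bilinear [THEN iffD1])
qed

lemma lie_bracket_jacobi:
  "lie_bracket x (lie_bracket y z) + lie_bracket y (lie_bracket z x)
    + lie_bracket z (lie_bracket x y) = 0"
  by (rule vec_8_eqI; simp add: lie_bracket_nth algebra_simps)

type_synonym L_dual = "L \<Rightarrow>\<^sub>L real"

definition h :: "8 \<Rightarrow> L_dual \<Rightarrow> real" where
  "h i \<xi> = blinfun_apply \<xi> (X i)"

text \<open>\<open>h_dual i\<close> is the element of the basis of \<open>L_dual\<close> dual to \<open>X\<close>.\<close>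

definition h_dual :: "8 \<Rightarrow> L_dual" where
  "h_dual i = blinfun_inner_right (X i)"

lemma h_h_dual: "h j (h_dual i) = (if i = j then 1 else 0)"
  by (simp add: h_def h_dual_def inner_axis_axis)

text \<open>
  In finite dimension a function is \<open>C^(k+1)\<close> iff it is differentiable and all its directional
  derivatives are \<open>C^k\<close>.
\<close>

fun Ck :: "nat \<Rightarrow> ('a::real_normed_vector \<Rightarrow> real) \<Rightarrow> bool" where
  "Ck 0 f \<longleftrightarrow> continuous_on UNIV f"
| "Ck (Suc k) f \<longleftrightarrow>
    (\<forall>x. f differentiable (at x)) \<and> (\<forall>v. Ck k (\<lambda>x. frechet_derivative f (at x) v))"

definition smooth :: "('a::real_normed_vector \<Rightarrow> real) \<Rightarrow> bool" where
  "smooth f \<longleftrightarrow> (\<forall>k. Ck k f)"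

text \<open>Only meaningful where \<open>f\<close> is differentiable.\<close>

definition differential :: "('a::real_normed_vector \<Rightarrow> real) \<Rightarrow> 'a \<Rightarrow> ('a \<Rightarrow>\<^sub>L real)" where
  "differential f x = Blinfun (frechet_derivative f (at x))"

definition functions_independent_at ::
    "('a::real_normed_vector \<Rightarrow> real) list \<Rightarrow> 'a \<Rightarrow> bool" where
  "functions_independent_at fs x \<longleftrightarrow>
    distinct (map (\<lambda>f. differential f x) fs) \<and>
    independent (set (map (\<lambda>f. differential f x) fs))"

text \<open>The element of \<open>L\<close> that corresponds to the differential of \<open>f\<close> at \<open>\<xi>\<close> under the
  identification of \<open>L\<close> with its bidual.\<close>

definition grad :: "(L_dual \<Rightarrow> real) \<Rightarrow> L_dual \<Rightarrow> L" where
  "grad f \<xi> = (\<Sum>i\<in>UNIV. blinfun_apply (differential f \<xi>) (h_dual i) *\<^sub>R X i)"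

text \<open>Equivalently, \<open>poisson f g\<close> is the sum over \<open>i, j\<close> of
  \<open>(\<partial>f/\<partial>h i) (\<partial>g/\<partial>h j) {h i, h j}\<close> with the values of \<open>{h i, h j}\<close> in \<open>poisson_h\<close>.\<close>

definition poisson :: "(L_dual \<Rightarrow> real) \<Rightarrow> (L_dual \<Rightarrow> real) \<Rightarrow> L_dual \<Rightarrow> real" where
  "poisson f g \<xi> = blinfun_apply \<xi> (lie_bracket (grad f \<xi>) (grad g \<xi>))"

lemma differential_eqI:
  assumes "(f has_derivative blinfun_apply D) (at x)"
  shows "differential f x = D"
  by (simp add: differential_def blinfun_apply_inverse flip: frechet_derivative_at [OF assms])

lemma grad_h: "grad (h i) \<xi> = X i"
proof -
  have bl: "bounded_linear (h i)"
    unfolding h_def by (rule blinfun.bounded_linear_left)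
  then have "(h i has_derivative blinfun_apply (Blinfun (h i))) (at \<xi>)"
    by (simp add: bounded_linear_Blinfun_apply bounded_linear_imp_has_derivative)
  then have "differential (h i) \<xi> = Blinfun (h i)"
    by (rule differential_eqI)
  then show ?thesis
    using bl by (simp add: grad_def bounded_linear_Blinfun_apply h_h_dual
        if_distrib [where f = "\<lambda>c. c *\<^sub>R _"] cong: if_cong)
qed

lemma poisson_h: "poisson (h i) (h j) \<xi> = blinfun_apply \<xi> (lie_bracket (X i) (X j))"
  by (simp add: poisson_def grad_h)

definition casimir :: "(L_dual \<Rightarrow> real) \<Rightarrow> bool" where
  "casimir f \<longleftrightarrow> smooth f \<and> (\<forall>i \<xi>. poisson f (h i) \<xi> = 0)"

definition C :: "L_dual \<Rightarrow> real" where
  "C \<xi> = (h 5 \<xi>)\<^sup>2 * h 6 \<xi> - 2 * h 4 \<xi> * h 5 \<xi> * h 7 \<xi> + (h 4 \<xi>)\<^sup>2 * h 8 \<xi>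
    - 2 * h 3 \<xi> * (h 6 \<xi> * h 8 \<xi> - (h 7 \<xi>)\<^sup>2)"

definition generic_set :: "L_dual set" where
  "generic_set = {\<xi>. h 6 \<xi> * h 8 \<xi> - (h 7 \<xi>)\<^sup>2 \<noteq> 0}"

end

theory Submission
  imports Defs
begin

text \<open>
  The four functions are Casimirs because \<open>X 6\<close>, \<open>X 7\<close>, \<open>X 8\<close> are central in \<open>L\<close> and the gradient
  of \<open>C\<close> at \<open>\<xi>\<close> lies in the kernel of the form \<open>(x, y) \<mapsto> \<xi> [x, y]\<close>. They are independent where
  \<open>\<Delta> = h 6 * h 8 - (h 7)\<^sup>2\<close> does not vanish because \<open>C\<close> is the only one of them that depends on
  \<open>h 3\<close>, with \<open>\<partial>C/\<partial>h 3 = - 2 * \<Delta>\<close>.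

  For the same reason, a common level set of the four functions inside \<open>\<Delta> \<noteq> 0\<close> is a graph of \<open>h 3\<close>
  over the free coordinates \<open>h 1\<close>, \<open>h 2\<close>, \<open>h 4\<close>, \<open>h 5\<close>, hence it is connected, and each of its points
  can be moved inside the level set to the one where these free coordinates vanish, simply by scaling
  them (\<open>level_path\<close>). The equations \<open>{f, h j} = 0\<close> for \<open>j = 1, 2, 4, 5\<close> are two linear systems
  with determinant \<open>\<Delta>\<close>, and they determine the partial derivatives of a Casimir \<open>f\<close> in the directions
  \<open>1\<close>, \<open>2\<close>, \<open>4\<close>, \<open>5\<close> from the one in direction \<open>3\<close> (\<open>casimir_partials\<close>); as a consequence \<open>f\<close> is
  constant along these paths (\<open>casimir_level_path\<close>). So the value of \<open>f\<close> at a point is its value at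
  the end of the path, and this end is an explicit function of \<open>h 6\<close>, \<open>h 7\<close>, \<open>h 8\<close> and \<open>C\<close>.
\<close>

section \<open>Coordinates on the dual space\<close>

lemma sum_8: "(\<Sum>i\<in>UNIV. F (i::8)) = F 1 + F 2 + F 3 + F 4 + F 5 + F 6 + F 7 + F 8"
  for F :: "8 \<Rightarrow> 'a::comm_monoid_add"
  unfolding UNIV_8_eq by (simp add: add.assoc)

lemma h_dual_apply: "blinfun_apply (h_dual i) v = v $ i"
  by (simp add: h_dual_def inner_axis')

lemma dual_apply: "blinfun_apply \<xi> v = (\<Sum>i\<in>UNIV. v $ i * h i \<xi>)"
proof -
  have "v = (\<Sum>i\<in>UNIV. v $ i *\<^sub>R X i)"
    using basis_expansion [of v] by (simp add: scalar_mult_eq_scaleR)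
  then have "blinfun_apply \<xi> v = blinfun_apply \<xi> (\<Sum>i\<in>UNIV. v $ i *\<^sub>R X i)"
    by simp
  also have "\<dots> = (\<Sum>i\<in>UNIV. v $ i * h i \<xi>)"
    by (simp add: blinfun.sum_right blinfun.scaleR_right h_def)
  finally show ?thesis .
qed

lemma dual_expansion: "\<xi> = (\<Sum>i\<in>UNIV. h i \<xi> *\<^sub>R h_dual i)"
proof (rule blinfun_eqI)
  fix v
  show "blinfun_apply \<xi> v = blinfun_apply (\<Sum>i\<in>UNIV. h i \<xi> *\<^sub>R h_dual i) v"
    by (simp add: dual_apply [of \<xi>] blinfun.sum_left blinfun.scaleR_left h_dual_apply mult.commute)
qed

lemma bounded_linear_h: "bounded_linear (h i)"
  unfolding h_def by (rule blinfun.bounded_linear_left)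

lemma h_has_derivative: "(h i has_derivative h i) (at \<xi> within S)"
  by (rule bounded_linear_imp_has_derivative [OF bounded_linear_h])

lemma h_linear: "h i (\<xi> + \<eta>) = h i \<xi> + h i \<eta>" "h i (\<xi> - \<eta>) = h i \<xi> - h i \<eta>"
    "h i (c *\<^sub>R \<xi>) = c * h i \<xi>"
  by (simp_all add: h_def blinfun.add_left blinfun.diff_left blinfun.scaleR_left)

section \<open>Smoothness of polynomial functions\<close>

lemma Ck_const: "Ck k (\<lambda>x. c)"
  by (induction k arbitrary: c) auto

lemma Ck_bounded_linear:
  assumes "bounded_linear f"
  shows "Ck k f"
proof (cases k)
  case 0
  then show ?thesis
    using assms by (simp add: linear_continuous_on)
next
  case (Suc m)
  have d: "(f has_derivative f) (at x)" for x
    using assms by (rule bounded_linear_imp_has_derivative)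
  then have "frechet_derivative f (at x) = f" for x
    by (metis frechet_derivative_at)
  with d Suc show ?thesis
    by (auto simp: Ck_const differentiable_def)
qed

lemma Ck_SucD: "Ck (Suc k) f \<Longrightarrow> Ck k f"
proof (induction k arbitrary: f)
  case 0
  then show ?case
    by (auto intro!: continuous_at_imp_continuous_on differentiable_imp_continuous_within)
next
  case (Suc k)
  from Suc.prems have "Ck (Suc k) (\<lambda>x. frechet_derivative f (at x) v)" for v
    by (metis Ck.simps(2))
  then have "Ck k (\<lambda>x. frechet_derivative f (at x) v)" for v
    by (rule Suc.IH)
  moreover have "\<forall>x. f differentiable (at x)"
    using Suc.prems by (metis Ck.simps(2))
  ultimately show ?case
    by simp
qed

lemma Ck_add: "Ck k f \<Longrightarrow> Ck k g \<Longrightarrow> Ck k (\<lambda>x. f x + g x)"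
proof (induction k arbitrary: f g)
  case 0
  then show ?case
    by (auto intro: continuous_intros)
next
  case (Suc k)
  then have "f differentiable (at x)" "g differentiable (at x)" for x
    by auto
  moreover from this have "frechet_derivative (\<lambda>x. f x + g x) (at x) =
      (\<lambda>v. frechet_derivative f (at x) v + frechet_derivative g (at x) v)" for x
    by (intro frechet_derivative_at [symmetric] has_derivative_add)
      (simp_all add: frechet_derivative_works [symmetric])
  ultimately show ?case
    using Suc by auto
qed

text \<open>The Leibniz rule expresses the derivatives of the product by those of the factors and by the
  factors themselves, so the induction needs that \<open>C^(k+1)\<close> implies \<open>C^k\<close>.\<close>

lemma Ck_mult: "Ck k f \<Longrightarrow> Ck k g \<Longrightarrow> Ck k (\<lambda>x. f x * g x)"
proof (induction k arbitrary: f g)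
  case 0
  then show ?case
    by (auto intro: continuous_intros)
next
  case (Suc k)
  then have diff: "f differentiable (at x)" "g differentiable (at x)" for x
    by auto
  then have leibniz: "frechet_derivative (\<lambda>x. f x * g x) (at x) =
      (\<lambda>v. f x * frechet_derivative g (at x) v + frechet_derivative f (at x) v * g x)" for x
    by (intro frechet_derivative_at [symmetric] has_derivative_mult)
      (simp_all add: frechet_derivative_works [symmetric])
  have "Ck k f" "Ck k g"
    using Suc.prems by (blast dest: Ck_SucD)+
  moreover have "Ck k (\<lambda>x. frechet_derivative f (at x) v)"
    "Ck k (\<lambda>x. frechet_derivative g (at x) v)" for v
    using Suc.prems by auto
  ultimately have "Ck k (\<lambda>x. frechet_derivative (\<lambda>x. f x * g x) (at x) v)" for v
    unfolding leibniz by (intro Ck_add Suc.IH)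
  with diff show ?case
    by auto
qed

lemma smooth_const: "smooth (\<lambda>x. c)"
  by (simp add: smooth_def Ck_const)

lemma smooth_add: "smooth f \<Longrightarrow> smooth g \<Longrightarrow> smooth (\<lambda>x. f x + g x)"
  by (simp add: smooth_def Ck_add)

lemma smooth_mult: "smooth f \<Longrightarrow> smooth g \<Longrightarrow> smooth (\<lambda>x. f x * g x)"
  by (simp add: smooth_def Ck_mult)

lemma smooth_diff:
  assumes "smooth f" "smooth g"
  shows "smooth (\<lambda>x. f x - g x)"
proof -
  have "smooth (\<lambda>x. f x + (- 1) * g x)"
    using assms by (intro smooth_add smooth_mult smooth_const)
  then show ?thesis
    by simp
qed

lemma smooth_h: "smooth (h i)"
  by (simp add: smooth_def Ck_bounded_linear bounded_linear_h)

lemma smooth_C: "smooth C"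
  unfolding C_def [abs_def] power2_eq_square
  by (intro smooth_add smooth_diff smooth_mult smooth_const smooth_h)

lemma smooth_has_derivative:
  assumes "smooth f"
  shows "(f has_derivative blinfun_apply (differential f x)) (at x)"
proof -
  have "Ck (Suc 0) f"
    using assms by (simp only: smooth_def)
  then have "(f has_derivative frechet_derivative f (at x)) (at x)"
    by (simp add: frechet_derivative_works)
  then show ?thesis
    by (simp add: differential_def bounded_linear_Blinfun_apply has_derivative_bounded_linear)
qed

section \<open>The Poisson bracket in coordinates\<close>

lemma grad_nth: "grad f \<xi> $ i = blinfun_apply (differential f \<xi>) (h_dual i)"
proof -
  have "\<forall>i. grad f \<xi> $ i = blinfun_apply (differential f \<xi>) (h_dual i)"
    unfolding forall_8 by (simp add: grad_def sum_8 axis_def)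
  then show ?thesis ..
qed

lemma poisson_eqs:
  "poisson f (h 1) \<xi> = - (grad f \<xi> $ 2 * h 3 \<xi> + grad f \<xi> $ 3 * h 4 \<xi>
    + grad f \<xi> $ 4 * h 6 \<xi> + grad f \<xi> $ 5 * h 7 \<xi>)"
  "poisson f (h 2) \<xi> = grad f \<xi> $ 1 * h 3 \<xi> - grad f \<xi> $ 3 * h 5 \<xi>
    - grad f \<xi> $ 4 * h 7 \<xi> - grad f \<xi> $ 5 * h 8 \<xi>"
  "poisson f (h 3) \<xi> = grad f \<xi> $ 1 * h 4 \<xi> + grad f \<xi> $ 2 * h 5 \<xi>"
  "poisson f (h 4) \<xi> = grad f \<xi> $ 1 * h 6 \<xi> + grad f \<xi> $ 2 * h 7 \<xi>"
  "poisson f (h 5) \<xi> = grad f \<xi> $ 1 * h 7 \<xi> + grad f \<xi> $ 2 * h 8 \<xi>"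
  "poisson f (h 6) \<xi> = 0" "poisson f (h 7) \<xi> = 0" "poisson f (h 8) \<xi> = 0"
  by (simp_all add: poisson_def grad_h dual_apply [of \<xi>] sum_8 lie_bracket_nth axis_def)

lemma differential_h: "blinfun_apply (differential (h i) \<xi>) \<eta> = h i \<eta>"
proof -
  have "differential (h i) \<xi> = Blinfun (h i)"
    by (rule differential_eqI)
      (simp add: bounded_linear_Blinfun_apply bounded_linear_h h_has_derivative)
  then show ?thesis
    by (simp add: bounded_linear_Blinfun_apply bounded_linear_h)
qed

lemma differential_C:
  "blinfun_apply (differential C \<xi>) \<eta> =
    - 2 * (h 6 \<xi> * h 8 \<xi> - (h 7 \<xi>)\<^sup>2) * h 3 \<eta>
    + 2 * (h 4 \<xi> * h 8 \<xi> - h 5 \<xi> * h 7 \<xi>) * h 4 \<eta>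
    + 2 * (h 5 \<xi> * h 6 \<xi> - h 4 \<xi> * h 7 \<xi>) * h 5 \<eta>
    + ((h 5 \<xi>)\<^sup>2 - 2 * h 3 \<xi> * h 8 \<xi>) * h 6 \<eta>
    + (4 * h 3 \<xi> * h 7 \<xi> - 2 * h 4 \<xi> * h 5 \<xi>) * h 7 \<eta>
    + ((h 4 \<xi>)\<^sup>2 - 2 * h 3 \<xi> * h 6 \<xi>) * h 8 \<eta>" (is "_ = ?D \<eta>")
proof -
  have D: "(C has_derivative ?D) (at \<xi>)"
    unfolding C_def [abs_def]
    by (rule derivative_eq_intros h_has_derivative refl)+
      (auto simp: algebra_simps power2_eq_square)
  then have "differential C \<xi> = Blinfun ?D"
    by (intro differential_eqI)
      (simp add: bounded_linear_Blinfun_apply has_derivative_bounded_linear)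
  then show ?thesis
    using has_derivative_bounded_linear [OF D] by (simp add: bounded_linear_Blinfun_apply)
qed

lemma casimir_h_central:
  assumes "k \<in> {6, 7, 8}"
  shows "casimir (h k)"
proof -
  have "\<forall>j. poisson (h k) (h j) \<xi> = 0" for \<xi>
    using assms unfolding forall_8 by (auto simp: poisson_eqs grad_h axis_def)
  then show ?thesis
    by (simp add: casimir_def smooth_h)
qed

lemma casimir_C: "casimir C"
proof -
  have "\<forall>j. poisson C (h j) \<xi> = 0" for \<xi>
    unfolding forall_8
    by (simp add: poisson_eqs grad_nth differential_C h_h_dual algebra_simps power2_eq_square)
  then show ?thesis
    by (simp add: casimir_def smooth_C)
qed

section \<open>Independence\<close>

lemma functions_independent_at_Cons:
  assumes fs: "functions_independent_at fs x"
    and nz: "blinfun_apply (differential f x) v \<noteq> 0"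
    and z: "\<And>g. g \<in> set fs \<Longrightarrow> blinfun_apply (differential g x) v = 0"
  shows "functions_independent_at (f # fs) x"
proof -
  let ?S = "(\<lambda>g. differential g x) ` set fs"
  have "subspace {D. blinfun_apply D v = 0}"
    by (auto simp: subspace_def blinfun.add_left blinfun.scaleR_left)
  then have "span ?S \<subseteq> {D. blinfun_apply D v = 0}"
    using z by (intro span_minimal) auto
  with nz have "differential f x \<notin> span ?S"
    by auto
  then show ?thesis
    using fs span_base [of "differential f x" ?S]
    by (auto simp: functions_independent_at_def independent_insert)
qed

text \<open>For \<open>k = 6, 7, 8\<close> the witness vector is the \<open>k\<close>-th dual basis vector, corrected by a multiple
  of the third one so that it is tangent to the level set of \<open>C\<close>.\<close>

lemma independent_h_C:
  assumes "\<xi> \<in> generic_set"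
  shows "functions_independent_at [h 6, h 7, h 8, C] \<xi>"
proof -
  define \<Delta> where "\<Delta> = h 6 \<xi> * h 8 \<xi> - (h 7 \<xi>)\<^sup>2"
  have nz: "\<Delta> \<noteq> 0"
    using assms by (simp add: generic_set_def \<Delta>_def)
  have C3: "blinfun_apply (differential C \<xi>) (h_dual 3) = - 2 * \<Delta>"
    by (simp add: differential_C h_h_dual \<Delta>_def)
  define v where
    "v k = h_dual k + (blinfun_apply (differential C \<xi>) (h_dual k) / (2 * \<Delta>)) *\<^sub>R h_dual 3" for k
  have Cv: "blinfun_apply (differential C \<xi>) (v k) = 0" for k
    using nz by (simp add: v_def blinfun.add_right blinfun.scaleR_right C3)
  have hv: "blinfun_apply (differential (h j) \<xi>) (v k) = (if k = j then 1 else 0)"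
    if "j \<noteq> 3" for j k
    using that by (simp add: differential_h v_def h_linear h_h_dual)
  have "functions_independent_at [C] \<xi>"
    by (rule functions_independent_at_Cons [where v = "h_dual 3"])
      (use nz C3 in \<open>auto simp: functions_independent_at_def independent_empty\<close>)
  then have "functions_independent_at [h 8, C] \<xi>"
    by (rule functions_independent_at_Cons [where v = "v 8"]) (auto simp: Cv hv)
  then have "functions_independent_at [h 7, h 8, C] \<xi>"
    by (rule functions_independent_at_Cons [where v = "v 7"]) (auto simp: Cv hv)
  then show ?thesis
    by (rule functions_independent_at_Cons [where v = "v 6"]) (auto simp: Cv hv)
qed

section \<open>Casimir functions are constant on level sets\<close>

text \<open>Cramer's rule for the brackets with \<open>h 4\<close>, \<open>h 5\<close> gives the first two equations. Then only the
  partial derivatives \<open>3\<close>, \<open>4\<close>, \<open>5\<close> are left in the brackets with \<open>h 1\<close>, \<open>h 2\<close>, and Cramer's rule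
  for these brackets gives the other two.\<close>

lemma casimir_partials:
  assumes f: "casimir f" and "\<xi> \<in> generic_set"
  defines "\<Delta> \<equiv> h 6 \<xi> * h 8 \<xi> - (h 7 \<xi>)\<^sup>2"
  shows "grad f \<xi> $ 1 = 0" "grad f \<xi> $ 2 = 0"
    "\<Delta> * grad f \<xi> $ 4 = (h 5 \<xi> * h 7 \<xi> - h 4 \<xi> * h 8 \<xi>) * grad f \<xi> $ 3"
    "\<Delta> * grad f \<xi> $ 5 = (h 4 \<xi> * h 7 \<xi> - h 5 \<xi> * h 6 \<xi>) * grad f \<xi> $ 3"
proof -
  have nz: "\<Delta> \<noteq> 0"
    using assms(2) by (simp add: generic_set_def \<Delta>_def)
  have p: "poisson f (h j) \<xi> = 0" for j
    using f by (simp add: casimir_def)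
  note e4 = p [of 4, unfolded poisson_eqs] and e5 = p [of 5, unfolded poisson_eqs]
  have "\<Delta> * grad f \<xi> $ 1 = 0" "\<Delta> * grad f \<xi> $ 2 = 0"
    using e4 e5 unfolding \<Delta>_def power2_eq_square by algebra+
  with nz show g: "grad f \<xi> $ 1 = 0" "grad f \<xi> $ 2 = 0"
    by simp_all
  have e1: "grad f \<xi> $ 3 * h 4 \<xi> + grad f \<xi> $ 4 * h 6 \<xi> + grad f \<xi> $ 5 * h 7 \<xi> = 0"
    and e2: "grad f \<xi> $ 3 * h 5 \<xi> + grad f \<xi> $ 4 * h 7 \<xi> + grad f \<xi> $ 5 * h 8 \<xi> = 0"
    using p [of 1] p [of 2] by (simp_all add: poisson_eqs g)
  show "\<Delta> * grad f \<xi> $ 4 = (h 5 \<xi> * h 7 \<xi> - h 4 \<xi> * h 8 \<xi>) * grad f \<xi> $ 3"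
    "\<Delta> * grad f \<xi> $ 5 = (h 4 \<xi> * h 7 \<xi> - h 5 \<xi> * h 6 \<xi>) * grad f \<xi> $ 3"
    using e1 e2 unfolding \<Delta>_def power2_eq_square by algebra+
qed

text \<open>The first coefficient is the value of \<open>h 3\<close> that gives \<open>C\<close> the value \<open>d\<close> when \<open>h 4\<close> and \<open>h 5\<close>
  vanish.\<close>

definition level_base :: "real \<Rightarrow> real \<Rightarrow> real \<Rightarrow> real \<Rightarrow> L_dual" where
  "level_base a b c d = (- d / (2 * (a * c - b\<^sup>2))) *\<^sub>R h_dual 3
    + a *\<^sub>R h_dual 6 + b *\<^sub>R h_dual 7 + c *\<^sub>R h_dual 8"

text \<open>The free coordinates are scaled by \<open>t\<close>. The part of \<open>C\<close> that is quadratic in \<open>h 4\<close> and \<open>h 5\<close>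
  then scales by \<open>t\<^sup>2\<close>, and the coefficient of \<open>h_dual 3\<close> compensates for it so that \<open>C\<close> keeps its
  value.\<close>

definition level_path :: "L_dual \<Rightarrow> real \<Rightarrow> L_dual" where
  "level_path \<xi> t = level_base (h 6 \<xi>) (h 7 \<xi>) (h 8 \<xi>) (C \<xi>)
    + t *\<^sub>R (h 1 \<xi> *\<^sub>R h_dual 1 + h 2 \<xi> *\<^sub>R h_dual 2 + h 4 \<xi> *\<^sub>R h_dual 4 + h 5 \<xi> *\<^sub>R h_dual 5)
    + (t\<^sup>2 * (((h 5 \<xi>)\<^sup>2 * h 6 \<xi> - 2 * h 4 \<xi> * h 5 \<xi> * h 7 \<xi> + (h 4 \<xi>)\<^sup>2 * h 8 \<xi>)
        / (2 * (h 6 \<xi> * h 8 \<xi> - (h 7 \<xi>)\<^sup>2)))) *\<^sub>R h_dual 3"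

lemma h_level_path:
  "h 4 (level_path \<xi> t) = t * h 4 \<xi>" "h 5 (level_path \<xi> t) = t * h 5 \<xi>"
  "h 6 (level_path \<xi> t) = h 6 \<xi>" "h 7 (level_path \<xi> t) = h 7 \<xi>" "h 8 (level_path \<xi> t) = h 8 \<xi>"
  by (simp_all add: level_path_def level_base_def h_linear h_h_dual)

lemma level_path_0: "level_path \<xi> 0 = level_base (h 6 \<xi>) (h 7 \<xi>) (h 8 \<xi>) (C \<xi>)"
  by (simp add: level_path_def)

lemma level_path_1:
  assumes "\<xi> \<in> generic_set"
  shows "level_path \<xi> 1 = \<xi>"
proof -
  define \<Delta> where "\<Delta> = h 6 \<xi> * h 8 \<xi> - (h 7 \<xi>)\<^sup>2"
  define Q where "Q = (h 5 \<xi>)\<^sup>2 * h 6 \<xi> - 2 * h 4 \<xi> * h 5 \<xi> * h 7 \<xi> + (h 4 \<xi>)\<^sup>2 * h 8 \<xi>"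
  have "\<Delta> \<noteq> 0"
    using assms by (simp add: generic_set_def \<Delta>_def)
  moreover have "C \<xi> = Q - 2 * h 3 \<xi> * \<Delta>"
    by (simp add: C_def Q_def \<Delta>_def)
  ultimately have h3: "- C \<xi> / (2 * \<Delta>) + Q / (2 * \<Delta>) = h 3 \<xi>"
    by (simp add: field_simps)
  have "level_path \<xi> 1 = h 1 \<xi> *\<^sub>R h_dual 1 + h 2 \<xi> *\<^sub>R h_dual 2
      + (- C \<xi> / (2 * \<Delta>) + Q / (2 * \<Delta>)) *\<^sub>R h_dual 3 + h 4 \<xi> *\<^sub>R h_dual 4
      + h 5 \<xi> *\<^sub>R h_dual 5 + h 6 \<xi> *\<^sub>R h_dual 6 + h 7 \<xi> *\<^sub>R h_dual 7 + h 8 \<xi> *\<^sub>R h_dual 8"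
    unfolding scaleR_add_left
    by (simp add: level_path_def level_base_def \<Delta>_def Q_def)
  also have "\<dots> = \<xi>"
    unfolding h3 by (rule dual_expansion [of \<xi>, unfolded sum_8, symmetric])
  finally show ?thesis .
qed

text \<open>By \<open>casimir_partials\<close>, the derivative along the path is a multiple of the partial derivative of
  \<open>f\<close> in direction \<open>3\<close>. The factor is the sum of the contribution of \<open>h 4\<close> and \<open>h 5\<close>, which is
  \<open>- t * Q / \<Delta>\<close>, and of the velocity \<open>t * Q / \<Delta>\<close> of \<open>h 3\<close>, so it vanishes.\<close>

lemma casimir_level_path:
  assumes f: "casimir f" and \<xi>: "\<xi> \<in> generic_set"
  shows "f (level_path \<xi> s) = f (level_path \<xi> t)"
proof -
  define \<Delta> where "\<Delta> = h 6 \<xi> * h 8 \<xi> - (h 7 \<xi>)\<^sup>2"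
  define Q where "Q = (h 5 \<xi>)\<^sup>2 * h 6 \<xi> - 2 * h 4 \<xi> * h 5 \<xi> * h 7 \<xi> + (h 4 \<xi>)\<^sup>2 * h 8 \<xi>"
  define u where "u = h 1 \<xi> *\<^sub>R h_dual 1 + h 2 \<xi> *\<^sub>R h_dual 2 + h 4 \<xi> *\<^sub>R h_dual 4
    + h 5 \<xi> *\<^sub>R h_dual 5"
  have nz: "\<Delta> \<noteq> 0"
    using \<xi> by (simp add: generic_set_def \<Delta>_def)
  have "((\<lambda>t. f (level_path \<xi> t)) has_real_derivative 0) (at t)" for t
  proof -
    let ?p = "level_path \<xi> t"
    have path: "level_path \<xi> = (\<lambda>t. level_base (h 6 \<xi>) (h 7 \<xi>) (h 8 \<xi>) (C \<xi>) + t *\<^sub>R u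
        + (t\<^sup>2 * (Q / (2 * \<Delta>))) *\<^sub>R h_dual 3)"
      by (simp add: fun_eq_iff level_path_def u_def Q_def \<Delta>_def)
    have "(level_path \<xi> has_derivative
        (\<lambda>r. r *\<^sub>R (u + (t * (Q / \<Delta>)) *\<^sub>R h_dual 3))) (at t)"
      unfolding path
      by (rule derivative_eq_intros refl | simp)+ (simp add: fun_eq_iff scaleR_add_right field_simps)
    from has_derivative_compose [OF this smooth_has_derivative]
    have der: "((\<lambda>t. f (level_path \<xi> t)) has_derivative
        (\<lambda>r. blinfun_apply (differential f ?p) (r *\<^sub>R (u + (t * (Q / \<Delta>)) *\<^sub>R h_dual 3)))) (at t)"
      using f by (simp add: casimir_def)
    have "?p \<in> generic_set"
      using \<xi> by (simp add: generic_set_def h_level_path)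
    note g = casimir_partials [OF f this, unfolded h_level_path, folded \<Delta>_def]
    have "blinfun_apply (differential f ?p) (u + (t * (Q / \<Delta>)) *\<^sub>R h_dual 3) =
        h 4 \<xi> * grad f ?p $ 4 + h 5 \<xi> * grad f ?p $ 5 + t * (Q / \<Delta>) * grad f ?p $ 3"
      using g(1,2) by (simp add: u_def blinfun.add_right blinfun.scaleR_right grad_nth)
    moreover have "\<Delta> * (h 4 \<xi> * grad f ?p $ 4 + h 5 \<xi> * grad f ?p $ 5
        + t * (Q / \<Delta>) * grad f ?p $ 3) =
        h 4 \<xi> * (\<Delta> * grad f ?p $ 4) + h 5 \<xi> * (\<Delta> * grad f ?p $ 5) + t * Q * grad f ?p $ 3"
      using nz by (simp add: algebra_simps)
    moreover have "\<dots> = 0"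
      unfolding g(3,4) Q_def by (simp add: algebra_simps power2_eq_square)
    ultimately have "blinfun_apply (differential f ?p) (u + (t * (Q / \<Delta>)) *\<^sub>R h_dual 3) = 0"
      using nz by simp
    with der show ?thesis
      by (simp add: has_field_derivative_def blinfun.scaleR_right lambda_zero)
  qed
  then show ?thesis
    by (intro DERIV_isconst_all) blast
qed

lemma casimir_eq_level_base:
  assumes "casimir f" "\<xi> \<in> generic_set"
  shows "f \<xi> = f (level_base (h 6 \<xi>) (h 7 \<xi>) (h 8 \<xi>) (C \<xi>))"
  using casimir_level_path [OF assms, of 1 0] assms(2) by (simp add: level_path_0 level_path_1)

theorem theorem3:
  shows "casimir (h 6) \<and> casimir (h 7) \<and> casimir (h 8) \<and> casimir C
    \<and> (\<forall>\<xi> \<in> generic_set. functions_independent_at [h 6, h 7, h 8, C] \<xi>)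
    \<and> (\<forall>f. casimir f \<longrightarrow>
          (\<exists>F :: real \<Rightarrow> real \<Rightarrow> real \<Rightarrow> real \<Rightarrow> real.
             \<forall>\<xi> \<in> generic_set. f \<xi> = F (h 6 \<xi>) (h 7 \<xi>) (h 8 \<xi>) (C \<xi>)))"
proof (intro conjI allI impI ballI)
  show "casimir (h 6)" "casimir (h 7)" "casimir (h 8)"
    by (simp_all add: casimir_h_central)
  show "casimir C"
    by (rule casimir_C)
  show "functions_independent_at [h 6, h 7, h 8, C] \<xi>" if "\<xi> \<in> generic_set" for \<xi>
    using that by (rule independent_h_C)
  show "\<exists>F. \<forall>\<xi> \<in> generic_set. f \<xi> = F (h 6 \<xi>) (h 7 \<xi>) (h 8 \<xi>) (C \<xi>)" if "casimir f" for f
    using casimir_eq_level_base [OF that]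
    by (intro exI [where x = "\<lambda>a b c d. f (level_base a b c d)"]) blast
qed

end
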